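(* Let $X=(Z,X_1)$ be an $\Omega$-$1$-polygraph. If the set $\partial(X_1)=\{s(\alpha)-t(\alpha)\mid\alpha\in X_1\}$ forms a Gröbner–Shirshov basis of $\mathscr A_\Omega(Z)$ with respect to a monomial order $\prec$ compatible with $X_1$, then $X$ is convergent.
   Context: $\mathbf k$ is a field of characteristic zero, $\Omega$ is a set, algebras are associative and unital over $\mathbf k$. For a set $Z$, the free $\Omega$-monoid $Z^\Omega$ is the union of $Z^\Omega_0=Z^*\subset Z^\Omega_1\subset\cdots$, $Z_n^\Omega=(Z\sqcup\{\lfloor u\rfloor_\tau: u\in Z^\Omega_{n-1},\tau\in\Omega\})^*$, with operators $u\mapsto\lfloor u\rfloor_\tau$. $\mathscr A_\Omega(Z)$ is the $\mathbf k$-linear span of $Z^\Omega$ (free $\Omega$-algebra); $\mathrm{supp}(a)$ is the set of monomials with nonzero coefficient in $a$. $Z^\Omega[\square]$ is the set of elements of $(Z\sqcup\{\square\})^\Omega$ in which $\square$ occurs exactly once; $q|_a$ denotes substitution of $a$ for $\square$, extended linearly in $a$. An $\Omega$-$1$-polygraph $X=(Z,X_1)$ is a set $Z$ and a set $X_1$ of rules $\alpha:s(\alpha)\to t(\alpha)$ with $s(\alpha),t(\alpha)\in\mathscr A_\Omega(Z)$; all are assumed left-monomial: $s(\alpha)\in Z^\Omega$ and $s(\alpha)\notin\mathrm{supp}(t(\alpha))$. A rewriting step is $\lambda q|_{s(\alpha)}+c\to\lambda q|_{t(\alpha)}+c$ with $\lambda\in\mathbf k\setminus\{0\}$, $\alpha\in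 X_1$, $q\in Z^\Omega[\square]$, $c\in\mathscr A_\Omega(Z)$, $q|_{s(\alpha)}\notin\mathrm{supp}(c)$. $X$ is terminating if there is no infinite sequence of rewriting steps; confluent if any two finite (possibly empty) sequences of rewriting steps from the same element can be continued to a common element; convergent if both. A monomial order on $Z^\Omega$ is a well-founded total order $\prec$ such that $u\prec v$ implies $q|_u\prec q|_v$ for all $q\in Z^\Omega[\square]$. It is compatible with $X_1$ if $v\prec s(\alpha)$ for all $\alpha\in X_1$ and $v\in\mathrm{supp}(t(\alpha))$. $\mathrm{lm}_\prec(c)$ is the $\prec$-maximal element of $\mathrm{supp}(c)$, $c\ne0$. Critical branchings of $X$ are of two shapes: intersection branchings, given by rules $f:uv\to a$, $g:vw\to b$ with $u,v,w\in Z^\Omega\setminus\{1\}$ (source $r=uvw$), and inclusion branchings, given by rules $h:v'\to a'$, $k:q|_{v'}\to b'$ with $v'\in Z^\Omega\setminus\{1\}$, $q\in Z^\Omega[\square]$, $q\ne\square$ (source $r=q|_{v'}$). Associated $0$-cells: $(a,b)_r=aw-ub$, resp. $(a',b')_r=q|_{a'}-b'$. For $S\subset\mathscr A_\Omega(Z)$, an element $c$ is trivial modulo $(S,r)$ if $c=\sum_i\lambda_i\,q_i|_{s_i}$ with $\lambda_i\in\mathbf k$, $q_i\in Z^\Omega[\square]$, $s_i\in S$ and $q_i|_{\mathrm{lm}_\prec(s_i)}\prec r$. A nonzero subset $S$ is a Gröbner–Shirshov basis of $\mathscr A_\Omega(Z)$ with respect to $\prec$ if for all critical branchings of $X$ the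 associated $0$-cells are trivial modulo $(S,r)$.
   Formalization: Inclusion branchings also include q = □ for two distinct rules with the same source (0-cell a'−b'); with q ≠ □ always required the claim is false, e.g. for the rules x→y and x→z with Ω empty and x > y > z. *)

theory Defs
  imports Complex_Main "HOL-Library.Poly_Mapping"
begin

text \<open>
  The set of generators and the set of operator labels are explicit carrier sets, so that either
  of them may be empty.
\<close>

datatype ('z, 'o) letter = Gen 'z | Op 'o "('z, 'o) letter list"

type_synonym ('z, 'o) word = "('z, 'o) letter list"

primrec free_monoid_level :: "'o set \<Rightarrow> 'z set \<Rightarrow> nat \<Rightarrow> ('z, 'o) word set" where
  "free_monoid_level \<Omega> Z 0 = lists (Gen ` Z)"
| "free_monoid_level \<Omega> Z (Suc n) =
     lists (Gen ` Z \<union> {Op \<tau> u | \<tau> u. \<tau> \<in> \<Omega> \<and> u \<in> free_monoid_level \<Omega> Z n})"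

definition free_monoid :: "'o set \<Rightarrow> 'z set \<Rightarrow> ('z, 'o) word set" where
  "free_monoid \<Omega> Z = (\<Union>n. free_monoid_level \<Omega> Z n)"

text \<open>
  One-hole contexts are words over \<open>Z\<close> and a hole, encoded with \<open>None\<close> as the hole.
\<close>

primrec holes_letter :: "('z option, 'o) letter \<Rightarrow> nat" where
  "holes_letter (Gen x) = (if x = None then 1 else 0)"
| "holes_letter (Op \<tau> w) = sum_list (map holes_letter w)"

definition holes :: "('z option, 'o) word \<Rightarrow> nat" where
  "holes q = sum_list (map holes_letter q)"

abbreviation hole :: "('z option, 'o) word" where
  "hole \<equiv> [Gen None]"

definition contexts :: "'o set \<Rightarrow> 'z set \<Rightarrow> ('z option, 'o) word set" where
  "contexts \<Omega> Z = {q \<in> free_monoid \<Omega> (insert None (Some ` Z)). holes q = 1}"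

primrec plug_letter :: "('z, 'o) word \<Rightarrow> ('z option, 'o) letter \<Rightarrow> ('z, 'o) word" where
  "plug_letter u (Gen x) = (case x of None \<Rightarrow> u | Some z \<Rightarrow> [Gen z])"
| "plug_letter u (Op \<tau> w) = [Op \<tau> (concat (map (plug_letter u) w))]"

definition plug :: "('z option, 'o) word \<Rightarrow> ('z, 'o) word \<Rightarrow> ('z, 'o) word" where
  "plug q u = concat (map (plug_letter u) q)"

text \<open>
  Elements of the free algebra are finitely supported coefficient functions on words;
  \<open>Poly_Mapping.keys a\<close> is the support of \<open>a\<close>.
\<close>

type_synonym ('z, 'o, 'k) lincomb = "('z, 'o) word \<Rightarrow>\<^sub>0 'k"

definition free_algebra :: "'o set \<Rightarrow> 'z set \<Rightarrow> ('z, 'o, 'k::field_char_0) lincomb set" where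
  "free_algebra \<Omega> Z = {a. Poly_Mapping.keys a \<subseteq> free_monoid \<Omega> Z}"

abbreviation monom :: "('z, 'o) word \<Rightarrow> ('z, 'o, 'k::field_char_0) lincomb" where
  "monom u \<equiv> Poly_Mapping.single u 1"

definition scale :: "'k \<Rightarrow> ('z, 'o, 'k::field_char_0) lincomb \<Rightarrow> ('z, 'o, 'k) lincomb" where
  "scale c a = Poly_Mapping.map ((*) c) a"

definition mult :: "('z, 'o, 'k::field_char_0) lincomb \<Rightarrow> ('z, 'o, 'k) lincomb
    \<Rightarrow> ('z, 'o, 'k) lincomb" where
  "mult a b = (\<Sum>u\<in>Poly_Mapping.keys a. \<Sum>v\<in>Poly_Mapping.keys b.
     Poly_Mapping.single (u @ v) (Poly_Mapping.lookup a u * Poly_Mapping.lookup b v))"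

definition plug_lin :: "('z option, 'o) word \<Rightarrow> ('z, 'o, 'k::field_char_0) lincomb
    \<Rightarrow> ('z, 'o, 'k) lincomb" where
  "plug_lin q a = (\<Sum>u\<in>Poly_Mapping.keys a. Poly_Mapping.single (plug q u) (Poly_Mapping.lookup a u))"

text \<open>
  Polygraphs are left-monomial, hence the source of a rule is a word. Distinct rules may share
  their source (and target).
\<close>

record (overloaded) ('z, 'o, 'k::zero, 'r) polygraph =
  gens :: "'z set"
  rules :: "'r set"
  src :: "'r \<Rightarrow> ('z, 'o) word"
  tgt :: "'r \<Rightarrow> ('z, 'o, 'k) lincomb"

definition left_monomial_polygraph ::
    "'o set \<Rightarrow> ('z, 'o, 'k::field_char_0, 'r) polygraph \<Rightarrow> bool" where
  "left_monomial_polygraph \<Omega> X \<longleftrightarrow>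
     (\<forall>\<alpha>\<in>rules X. src X \<alpha> \<in> free_monoid \<Omega> (gens X) \<and>
                  tgt X \<alpha> \<in> free_algebra \<Omega> (gens X) \<and>
                  src X \<alpha> \<notin> Poly_Mapping.keys (tgt X \<alpha>))"

definition boundary :: "('z, 'o, 'k::field_char_0, 'r) polygraph \<Rightarrow> ('z, 'o, 'k) lincomb set" where
  "boundary X = {monom (src X \<alpha>) - tgt X \<alpha> | \<alpha>. \<alpha> \<in> rules X}"

definition rewriting_step :: "'o set \<Rightarrow> ('z, 'o, 'k::field_char_0, 'r) polygraph
    \<Rightarrow> ('z, 'o, 'k) lincomb \<Rightarrow> ('z, 'o, 'k) lincomb \<Rightarrow> bool" where
  "rewriting_step \<Omega> X a b \<longleftrightarrow>
     (\<exists>c0 \<alpha> q c. c0 \<noteq> 0 \<and> \<alpha> \<in> rules X \<and> q \<in> contexts \<Omega> (gens X) \<and>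
        c \<in> free_algebra \<Omega> (gens X) \<and> plug q (src X \<alpha>) \<notin> Poly_Mapping.keys c \<and>
        a = scale c0 (monom (plug q (src X \<alpha>))) + c \<and>
        b = scale c0 (plug_lin q (tgt X \<alpha>)) + c)"

definition terminating :: "'o set \<Rightarrow> ('z, 'o, 'k::field_char_0, 'r) polygraph \<Rightarrow> bool" where
  "terminating \<Omega> X \<longleftrightarrow> (\<nexists>f :: nat \<Rightarrow> _. \<forall>n. rewriting_step \<Omega> X (f n) (f (Suc n)))"

definition confluent :: "'o set \<Rightarrow> ('z, 'o, 'k::field_char_0, 'r) polygraph \<Rightarrow> bool" where
  "confluent \<Omega> X \<longleftrightarrow>
     (\<forall>a\<in>free_algebra \<Omega> (gens X). \<forall>b c.
        (rewriting_step \<Omega> X)\<^sup>*\<^sup>* a b \<and> (rewriting_step \<Omega> X)\<^sup>*\<^sup>* a c \<longrightarrow>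
        (\<exists>d. (rewriting_step \<Omega> X)\<^sup>*\<^sup>* b d \<and> (rewriting_step \<Omega> X)\<^sup>*\<^sup>* c d))"

definition convergent_polygraph ::
    "'o set \<Rightarrow> ('z, 'o, 'k::field_char_0, 'r) polygraph \<Rightarrow> bool" where
  "convergent_polygraph \<Omega> X \<longleftrightarrow> terminating \<Omega> X \<and> confluent \<Omega> X"

definition monomial_order ::
    "'o set \<Rightarrow> 'z set \<Rightarrow> (('z, 'o) word \<Rightarrow> ('z, 'o) word \<Rightarrow> bool) \<Rightarrow> bool" where
  "monomial_order \<Omega> Z prec \<longleftrightarrow>
     irreflp_on (free_monoid \<Omega> Z) prec \<and> transp_on (free_monoid \<Omega> Z) prec \<and>
     totalp_on (free_monoid \<Omega> Z) prec \<and> wfp_on (free_monoid \<Omega> Z) prec \<and>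
     (\<forall>q\<in>contexts \<Omega> Z. \<forall>u\<in>free_monoid \<Omega> Z. \<forall>v\<in>free_monoid \<Omega> Z.
        prec u v \<longrightarrow> prec (plug q u) (plug q v))"

definition compatible_order ::
    "('z, 'o, 'k::field_char_0, 'r) polygraph \<Rightarrow> (('z, 'o) word \<Rightarrow> ('z, 'o) word \<Rightarrow> bool) \<Rightarrow> bool"
  where
  "compatible_order X prec \<longleftrightarrow> (\<forall>\<alpha>\<in>rules X. \<forall>v\<in>Poly_Mapping.keys (tgt X \<alpha>). prec v (src X \<alpha>))"

definition leading_monomial :: "(('z, 'o) word \<Rightarrow> ('z, 'o) word \<Rightarrow> bool)
    \<Rightarrow> ('z, 'o, 'k::field_char_0) lincomb \<Rightarrow> ('z, 'o) word" where
  "leading_monomial prec c = (THE u. u \<in> Poly_Mapping.keys c \<and> (\<forall>v\<in>Poly_Mapping.keys c. v \<noteq> u \<longrightarrow> prec v u))"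

definition intersection_branching :: "'o set \<Rightarrow> ('z, 'o, 'k::field_char_0, 'r) polygraph
    \<Rightarrow> 'r \<Rightarrow> 'r \<Rightarrow> ('z, 'o) word \<Rightarrow> ('z, 'o) word \<Rightarrow> ('z, 'o) word \<Rightarrow> bool" where
  "intersection_branching \<Omega> X f g u v w \<longleftrightarrow>
     f \<in> rules X \<and> g \<in> rules X \<and>
     u \<in> free_monoid \<Omega> (gens X) - {[]} \<and> v \<in> free_monoid \<Omega> (gens X) - {[]} \<and>
     w \<in> free_monoid \<Omega> (gens X) - {[]} \<and>
     src X f = u @ v \<and> src X g = v @ w"

text \<open>
  The condition \<open>q \<noteq> hole\<close> serves to discard the trivial branching of a rule with itself. Two
  distinct rules with the same source do form a branching, with \<open>q = hole\<close>: otherwise the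
  polygraph with rules \<open>x \<rightarrow> y\<close> and \<open>x \<rightarrow> z\<close> on three generators would have no critical
  branching, although it is not confluent.
\<close>

definition inclusion_branching :: "'o set \<Rightarrow> ('z, 'o, 'k::field_char_0, 'r) polygraph
    \<Rightarrow> 'r \<Rightarrow> 'r \<Rightarrow> ('z option, 'o) word \<Rightarrow> ('z, 'o) word \<Rightarrow> bool" where
  "inclusion_branching \<Omega> X h k q v \<longleftrightarrow>
     h \<in> rules X \<and> k \<in> rules X \<and>
     v \<in> free_monoid \<Omega> (gens X) - {[]} \<and> q \<in> contexts \<Omega> (gens X) \<and>
     (q \<noteq> hole \<or> h \<noteq> k) \<and>
     src X h = v \<and> src X k = plug q v"

definition trivial_modulo :: "'o set \<Rightarrow> 'z set \<Rightarrow> (('z, 'o) word \<Rightarrow> ('z, 'o) word \<Rightarrow> bool)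
    \<Rightarrow> ('z, 'o, 'k::field_char_0) lincomb set \<Rightarrow> ('z, 'o) word \<Rightarrow> ('z, 'o, 'k) lincomb \<Rightarrow> bool"
  where
  "trivial_modulo \<Omega> Z prec S r c \<longleftrightarrow>
     (\<exists>(n::nat) l q s.
        (\<forall>i<n. q i \<in> contexts \<Omega> Z \<and> s i \<in> S \<and>
               prec (plug (q i) (leading_monomial prec (s i))) r) \<and>
        c = (\<Sum>i<n. scale (l i) (plug_lin (q i) (s i))))"

definition groebner_shirshov_basis :: "'o set \<Rightarrow> ('z, 'o, 'k::field_char_0, 'r) polygraph
    \<Rightarrow> (('z, 'o) word \<Rightarrow> ('z, 'o) word \<Rightarrow> bool) \<Rightarrow> ('z, 'o, 'k) lincomb set \<Rightarrow> bool" where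
  "groebner_shirshov_basis \<Omega> X prec S \<longleftrightarrow>
     S \<subseteq> free_algebra \<Omega> (gens X) \<and> \<not> S \<subseteq> {0} \<and>
     (\<forall>f g u v w. intersection_branching \<Omega> X f g u v w \<longrightarrow>
        trivial_modulo \<Omega> (gens X) prec S (u @ v @ w)
          (mult (tgt X f) (monom w) - mult (monom u) (tgt X g))) \<and>
     (\<forall>h k q v. inclusion_branching \<Omega> X h k q v \<longrightarrow>
        trivial_modulo \<Omega> (gens X) prec S (plug q v)
          (plug_lin q (tgt X h) - tgt X k))"

end

theory Submission
  imports Defs "HOL-Library.Multiset"
begin

text \<open>
  Termination: a rewriting step replaces a word in the support of an element by smaller ones, because
  the order is compatible with the rules and monotone under contexts. So supports decrease in the
  multiset extension of a well-founded order (\<open>rewriting_step_decreases\<close>).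

  Confluence is obtained from uniqueness of normal forms instead of from local confluence. Call an
  element \<open>q|\<^sub>s - q|\<^sub>t\<close>, for a rule \<open>s \<rightarrow> t\<close> and a context \<open>q\<close>, a relation with leading monomial \<open>q|\<^sub>s\<close>. Elements
  connected by rewriting differ by a combination of relations, and a normal form is an element whose
  support contains no leading monomial of a relation. So it suffices that every nonzero combination of
  relations has such a leading monomial in its support (\<open>relations_reducible\<close>), as the difference of two
  normal forms has none.

  The core is that two relations with the same leading monomial \<open>r\<close> differ by a combination of relations with
  leading monomials below \<open>r\<close> (\<open>same_source_relations\<close>). The two sources occur in \<open>r\<close> in one of three relative
  positions (\<open>occurrences_positioned\<close>): one inside the other, or overlapping, where the claim is the
  Groebner-Shirshov condition moved into a context; or disjoint, where it is a direct computation. Rules with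
  empty source are special, because every word contains the empty word everywhere: their target is \<open>0\<close>, so
  every word is a relation and the claim holds trivially.

  Finally, represent a nonzero combination of relations so that the largest leading monomial \<open>r\<close> is as small
  as possible. Up to relations with smaller leading monomials, those with leading monomial \<open>r\<close> merge into a
  multiple of one of them (\<open>relations_peel\<close>). The factor is not \<open>0\<close> by minimality, so \<open>r\<close> occurs in the support.
\<close>

section \<open>The free monoid with operators\<close>

lemma free_monoid_level_mono: "m \<le> n \<Longrightarrow> free_monoid_level \<Omega> Z m \<subseteq> free_monoid_level \<Omega> Z n"
proof (induction m arbitrary: n)
  case 0
  have "lists (Gen ` Z) \<subseteq> free_monoid_level \<Omega> Z n" by (cases n) (auto intro: lists_mono[THEN subsetD])
  then show ?case by simp
next
  case (Suc m)
  then obtain k where k: "n = Suc k" "m \<le> k" by (cases n) auto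
  show ?case unfolding k(1) free_monoid_level.simps
    using Suc.IH[OF k(2)] by (intro lists_mono) auto
qed

lemma Nil_in_free_monoid [simp]: "[] \<in> free_monoid \<Omega> Z"
  unfolding free_monoid_def by (auto intro: exI[of _ 0])

lemma Cons_in_free_monoid_iff:
  "l # w \<in> free_monoid \<Omega> Z \<longleftrightarrow> [l] \<in> free_monoid \<Omega> Z \<and> w \<in> free_monoid \<Omega> Z"
proof -
  have split: "l # w \<in> free_monoid_level \<Omega> Z n \<longleftrightarrow>
      [l] \<in> free_monoid_level \<Omega> Z n \<and> w \<in> free_monoid_level \<Omega> Z n" for n
    by (cases n) auto
  show ?thesis
  proof
    assume "l # w \<in> free_monoid \<Omega> Z"
    then show "[l] \<in> free_monoid \<Omega> Z \<and> w \<in> free_monoid \<Omega> Z"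
      unfolding free_monoid_def using split by blast
  next
    assume "[l] \<in> free_monoid \<Omega> Z \<and> w \<in> free_monoid \<Omega> Z"
    then obtain m n where "[l] \<in> free_monoid_level \<Omega> Z m" "w \<in> free_monoid_level \<Omega> Z n"
      unfolding free_monoid_def by blast
    then have "l # w \<in> free_monoid_level \<Omega> Z (max m n)"
      using free_monoid_level_mono[of m "max m n" \<Omega> Z]
        free_monoid_level_mono[of n "max m n" \<Omega> Z] split by auto
    then show "l # w \<in> free_monoid \<Omega> Z" unfolding free_monoid_def by blast
  qed
qed

lemma append_in_free_monoid_iff [simp]:
  "u @ v \<in> free_monoid \<Omega> Z \<longleftrightarrow> u \<in> free_monoid \<Omega> Z \<and> v \<in> free_monoid \<Omega> Z"
proof (induction u)
  case (Cons l u)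
  then show ?case
    using Cons_in_free_monoid_iff[of l "u @ v"] Cons_in_free_monoid_iff[of l u] by auto
qed simp

lemma Gen_in_free_monoid_iff [simp]: "[Gen z] \<in> free_monoid \<Omega> Z \<longleftrightarrow> z \<in> Z"
proof
  assume "[Gen z] \<in> free_monoid \<Omega> Z"
  then obtain n where "[Gen z] \<in> free_monoid_level \<Omega> Z n" unfolding free_monoid_def by blast
  then show "z \<in> Z" by (cases n) auto
next
  assume "z \<in> Z"
  then have "[Gen z] \<in> free_monoid_level \<Omega> Z 0" by simp
  then show "[Gen z] \<in> free_monoid \<Omega> Z" unfolding free_monoid_def by blast
qed

lemma Op_in_free_monoid_iff [simp]:
  "[Op \<tau> u] \<in> free_monoid \<Omega> Z \<longleftrightarrow> \<tau> \<in> \<Omega> \<and> u \<in> free_monoid \<Omega> Z"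
proof
  assume "[Op \<tau> u] \<in> free_monoid \<Omega> Z"
  then obtain n where "[Op \<tau> u] \<in> free_monoid_level \<Omega> Z n" unfolding free_monoid_def by blast
  then show "\<tau> \<in> \<Omega> \<and> u \<in> free_monoid \<Omega> Z" unfolding free_monoid_def by (cases n) auto
next
  assume "\<tau> \<in> \<Omega> \<and> u \<in> free_monoid \<Omega> Z"
  then obtain n where "\<tau> \<in> \<Omega>" "u \<in> free_monoid_level \<Omega> Z n" unfolding free_monoid_def by blast
  then have "[Op \<tau> u] \<in> free_monoid_level \<Omega> Z (Suc n)" by auto
  then show "[Op \<tau> u] \<in> free_monoid \<Omega> Z" unfolding free_monoid_def by blast
qed

lemma Op_Cons_in_free_monoid_iff [simp]:
  "Op \<tau> u # w \<in> free_monoid \<Omega> Z \<longleftrightarrow> \<tau> \<in> \<Omega> \<and> u \<in> free_monoid \<Omega> Z \<and> w \<in> free_monoid \<Omega> Z"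
  using Cons_in_free_monoid_iff[of "Op \<tau> u" w] by simp

lemma Gen_Cons_in_free_monoid_iff [simp]:
  "Gen z # w \<in> free_monoid \<Omega> Z \<longleftrightarrow> z \<in> Z \<and> w \<in> free_monoid \<Omega> Z"
  using Cons_in_free_monoid_iff[of "Gen z" w] by simp

section \<open>Contexts as maps on words\<close>

text \<open>
  A one-hole context is used through the map \<open>u \<mapsto> q|\<^sub>u\<close> that it induces. Composition of contexts is then
  composition of functions, and the path from the root to the hole becomes an induction principle:
  the hole is either at the top level or inside an operator letter. The lemmas
  \<open>context_map_plug\<close> and \<open>context_map_imp_plug\<close> below identify these maps with the contexts.
\<close>

inductive context_map :: "'o set \<Rightarrow> 'z set \<Rightarrow> (('z, 'o) word \<Rightarrow> ('z, 'o) word) \<Rightarrow> bool"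
  for \<Omega> Z where
  flat: "a \<in> free_monoid \<Omega> Z \<Longrightarrow> b \<in> free_monoid \<Omega> Z \<Longrightarrow> context_map \<Omega> Z (\<lambda>x. a @ x @ b)"
| nested: "context_map \<Omega> Z f \<Longrightarrow> a \<in> free_monoid \<Omega> Z \<Longrightarrow> b \<in> free_monoid \<Omega> Z \<Longrightarrow> \<tau> \<in> \<Omega> \<Longrightarrow>
    context_map \<Omega> Z (\<lambda>x. a @ Op \<tau> (f x) # b)"

lemma context_map_append_left: "c \<in> free_monoid \<Omega> Z \<Longrightarrow> context_map \<Omega> Z (\<lambda>x. c @ x)"
  using context_map.flat[of c \<Omega> Z "[]"] by simp

lemma context_map_in_free_monoid_iff:
  assumes "context_map \<Omega> Z f"
  shows "f u \<in> free_monoid \<Omega> Z \<longleftrightarrow> u \<in> free_monoid \<Omega> Z"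
  using assms by induction auto

lemma context_map_compose:
  assumes "context_map \<Omega> Z f" "context_map \<Omega> Z g"
  shows "context_map \<Omega> Z (\<lambda>x. f (g x))"
  using assms(1)
proof induction
  case (flat a b)
  from assms(2) show ?case
  proof cases
    case (flat a' b')
    then show ?thesis
      using context_map.flat[of "a @ a'" \<Omega> Z "b' @ b"] \<open>a \<in> _\<close> \<open>b \<in> _\<close> by simp
  next
    case (nested f' a' b' \<tau>)
    then show ?thesis
      using context_map.nested[of \<Omega> Z f' "a @ a'" "b' @ b" \<tau>] \<open>a \<in> _\<close> \<open>b \<in> _\<close> by simp
  qed
next
  case (nested f a b \<tau>)
  then show ?case by (intro context_map.nested)
qed

text \<open>
  A word is read as a word over the generators and the hole, in which the hole does not occur.
\<close>

abbreviation embed :: "('z, 'o) word \<Rightarrow> ('z option, 'o) word" where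
  "embed w \<equiv> map (map_letter Some (\<lambda>\<tau>. \<tau>)) w"

lemma embed_letter:
  fixes l :: "('z, 'o) letter"
  shows "plug_letter u (map_letter Some (\<lambda>\<tau>. \<tau>) l) = [l]"
    and "holes_letter (map_letter Some (\<lambda>\<tau>. \<tau>) l) = 0"
    and "[l] \<in> free_monoid \<Omega> Z \<Longrightarrow>
      [map_letter Some (\<lambda>\<tau>. \<tau>) l] \<in> free_monoid \<Omega> (insert None (Some ` Z))"
proof (induction l)
  case (Op \<tau> w)
  { case 1 show ?case using Op by (simp add: comp_def cong: map_cong) }
  { case 2 show ?case using Op by (simp add: comp_def cong: map_cong) }
  { case 3
    then have "w \<in> free_monoid \<Omega> Z" "\<tau> \<in> \<Omega>" by auto
    moreover from this(1) have "set w \<subseteq> {l. [l] \<in> free_monoid \<Omega> Z}"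
      by (induction w) (auto dest: Cons_in_free_monoid_iff[THEN iffD1])
    then have "embed v \<in> free_monoid \<Omega> (insert None (Some ` Z))" if "set v \<subseteq> set w" for v
      using that Op(3) by (induction v) (auto simp: Cons_in_free_monoid_iff[of "map_letter _ _ _" "embed _"])
    ultimately show ?case by simp }
qed auto

lemma embed:
  shows "plug (embed w) u = w" and "holes (embed w) = 0"
    and "w \<in> free_monoid \<Omega> Z \<Longrightarrow> embed w \<in> free_monoid \<Omega> (insert None (Some ` Z))"
proof (induction w)
  case (Cons l w)
  { case 1 show ?case using Cons embed_letter by (simp add: plug_def) }
  { case 2 show ?case using Cons embed_letter by (simp add: holes_def) }
  { case 3 then show ?case using Cons embed_letter(3)[of l \<Omega> Z]
      Cons_in_free_monoid_iff[of "map_letter Some (\<lambda>\<tau>. \<tau>) l" "embed w"] 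
      Cons_in_free_monoid_iff[of l w] by simp }
qed (auto simp: plug_def holes_def)

lemma plug_append [simp]: "plug (p @ q) u = plug p u @ plug q u"
  by (simp add: plug_def)

lemma plug_Cons_Op [simp]: "plug (Op \<tau> p # q) u = Op \<tau> (plug p u) # plug q u"
  by (simp add: plug_def)

lemma plug_Cons_Gen [simp]:
  "plug (Gen None # q) u = u @ plug q u" "plug (Gen (Some z) # q) u = Gen z # plug q u"
  by (simp_all add: plug_def)

lemma plug_Nil [simp]: "plug [] u = []"
  by (simp add: plug_def)

lemma holes_append [simp]: "holes (p @ q) = holes p + holes q"
  by (simp add: holes_def)

lemma holes_Cons [simp]:
  "holes (Op \<tau> p # q) = holes p + holes q" "holes (Gen x # q) = (if x = None then 1 else 0) + holes q"
  by (simp_all add: holes_def)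

lemma holes_Nil [simp]: "holes [] = 0"
  by (simp add: holes_def)

text \<open>
  Letters and words are mutually nested; this is the induction on words that also gives the
  hypothesis for the word under an operator.
\<close>

lemma word_induct [case_names Nil Gen Op]:
  assumes "P []" "\<And>z w. P w \<Longrightarrow> P (Gen z # w)" "\<And>\<tau> v w. P v \<Longrightarrow> P w \<Longrightarrow> P (Op \<tau> v # w)"
  shows "P w"
proof (induction w rule: measure_induct_rule[where f = "size_list size"])
  case (less w)
  show ?case
  proof (cases w)
    case (Cons l v)
    then show ?thesis using less assms by (cases l) auto
  qed (use assms in simp)
qed

lemma plug_without_holes:
  assumes "holes q = 0" "q \<in> free_monoid \<Omega> (insert None (Some ` Z))"
  obtains w where "w \<in> free_monoid \<Omega> Z" "plug q = (\<lambda>u. w)"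
proof -
  have "plug q [] \<in> free_monoid \<Omega> Z \<and> (\<forall>u. plug q u = plug q [])"
    using assms by (induction q rule: word_induct) (auto split: if_splits)
  then show ?thesis using that by blast
qed

lemma context_map_plug:
  assumes "q \<in> contexts \<Omega> Z"
  shows "context_map \<Omega> Z (plug q)"
proof -
  \<comment> \<open>The prefix \<open>a\<close> collects the letters that the induction has passed before it meets the hole.\<close>
  have "context_map \<Omega> Z (\<lambda>u. a @ plug q u)"
    if "holes q = 1" "q \<in> free_monoid \<Omega> (insert None (Some ` Z))" "a \<in> free_monoid \<Omega> Z" for q a
    using that
  proof (induction q arbitrary: a rule: word_induct)
    case (Gen x q)
    show ?case
    proof (cases x)
      case None
      then obtain w where "w \<in> free_monoid \<Omega> Z" "plug q = (\<lambda>u. w)"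
        using Gen.prems plug_without_holes[of q \<Omega> Z] by auto
      then show ?thesis using context_map.flat[OF Gen.prems(3), of w] None by simp
    next
      case (Some z)
      then show ?thesis using Gen.IH[of "a @ [Gen z]"] Gen.prems by auto
    qed
  next
    case (Op \<tau> p q)
    show ?case
    proof (cases "holes p = 0")
      case True
      then obtain w where "w \<in> free_monoid \<Omega> Z" "plug p = (\<lambda>u. w)"
        using Op.prems plug_without_holes[of p \<Omega> Z] by auto
      then show ?thesis using Op.IH(2)[of "a @ [Op \<tau> w]"] Op.prems True by simp
    next
      case False
      then have "holes p = 1" "holes q = 0" using Op.prems by auto
      moreover from this obtain w where "w \<in> free_monoid \<Omega> Z" "plug q = (\<lambda>u. w)"
        using Op.prems plug_without_holes[of q \<Omega> Z] by auto
      moreover have "context_map \<Omega> Z (plug p)" using Op.IH(1)[of "[]"] Op.prems \<open>holes p = 1\<close> by simp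
      ultimately show ?thesis
        using context_map.nested[of \<Omega> Z "plug p" a w \<tau>] Op.prems by simp
    qed
  qed auto
  from this[of q "[]"] show ?thesis using assms by (simp add: contexts_def)
qed

lemma context_map_imp_plug:
  assumes "context_map \<Omega> Z f"
  shows "\<exists>q\<in>contexts \<Omega> Z. f = plug q"
  using assms
proof induction
  case (flat a b)
  then show ?case
    by (intro bexI[of _ "embed a @ hole @ embed b"]) (auto simp: contexts_def embed fun_eq_iff)
next
  case (nested f a b \<tau>)
  then obtain q where "q \<in> contexts \<Omega> Z" "f = plug q" by auto
  with nested show ?case
    by (intro bexI[of _ "embed a @ [Op \<tau> q] @ embed b"]) (auto simp: contexts_def embed fun_eq_iff)
qed

section \<open>The relative position of two occurrences\<close>

text \<open>
  The ways in which an occurrence of \<open>u\<close>, with surrounding context \<open>f\<close>, can lie relative to an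
  occurrence of \<open>v\<close>, with surrounding context \<open>g\<close>, in the same word \<open>f u = g v\<close>. In the case
  \<open>disjoint\<close>, \<open>F\<close> is a context with two holes. It has to be a context only when its other hole is filled
  by a word of the free monoid, because \<open>F\<close> itself is defined on all words of the type.
  The relation is not symmetric: \<open>inside\<close> has the first occurrence within the second, and \<open>overlap\<close>
  has it on the left.
\<close>

inductive positioned :: "'o set \<Rightarrow> 'z set \<Rightarrow> (('z, 'o) word \<Rightarrow> ('z, 'o) word) \<Rightarrow> ('z, 'o) word
    \<Rightarrow> (('z, 'o) word \<Rightarrow> ('z, 'o) word) \<Rightarrow> ('z, 'o) word \<Rightarrow> bool"
  for \<Omega> Z where
  inside: "context_map \<Omega> Z g \<Longrightarrow> context_map \<Omega> Z h \<Longrightarrow> positioned \<Omega> Z (\<lambda>x. g (h x)) u g (h u)"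
| overlap: "context_map \<Omega> Z h \<Longrightarrow> a \<in> free_monoid \<Omega> Z - {[]} \<Longrightarrow> b \<in> free_monoid \<Omega> Z - {[]} \<Longrightarrow>
    c \<in> free_monoid \<Omega> Z - {[]} \<Longrightarrow>
    positioned \<Omega> Z (\<lambda>x. h (x @ c)) (a @ b) (\<lambda>x. h (a @ x)) (b @ c)"
| disjoint: "(\<And>y. y \<in> free_monoid \<Omega> Z \<Longrightarrow> context_map \<Omega> Z (\<lambda>x. F x y)) \<Longrightarrow>
    (\<And>x. x \<in> free_monoid \<Omega> Z \<Longrightarrow> context_map \<Omega> Z (F x)) \<Longrightarrow>
    positioned \<Omega> Z (\<lambda>x. F x v) u (F u) v"

lemma positioned_nested:
  assumes "positioned \<Omega> Z f u g v" "a \<in> free_monoid \<Omega> Z" "b \<in> free_monoid \<Omega> Z" "\<tau> \<in> \<Omega>"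
  shows "positioned \<Omega> Z (\<lambda>x. a @ Op \<tau> (f x) # b) u (\<lambda>x. a @ Op \<tau> (g x) # b) v"
  using assms(1)
proof cases
  case (inside h)
  then show ?thesis
    using positioned.inside[OF context_map.nested[OF inside(3) assms(2-4)]] by blast
next
  case (overlap h a' b' c')
  then show ?thesis
    using positioned.overlap[OF context_map.nested[OF overlap(5) assms(2-4)]] by blast
next
  case (disjoint F)
  show ?thesis unfolding disjoint(1,2)
    using positioned.disjoint[of \<Omega> Z "\<lambda>x y. a @ Op \<tau> (F x y) # b" v u]
      context_map.nested[OF disjoint(3) assms(2-4)] context_map.nested[OF disjoint(4) assms(2-4)]
    by simp
qed

lemma append_eq_append_cases:
  assumes "xs @ ys = zs @ ts"
  obtains (longer) e where "xs = zs @ e" "ts = e @ ys" | (shorter) e where "zs = xs @ e" "ys = e @ ts"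
  using assms by (metis append_eq_append_conv2)

lemma append_eq_append_Cons_cases:
  assumes "xs @ ys = zs @ l # ts"
  obtains (longer) e where "xs = zs @ l # e" "ts = e @ ys" | (shorter) e where "zs = xs @ e" "ys = e @ l # ts"
  using assms
proof (cases rule: append_eq_append_cases)
  case (longer e)
  then show ?thesis using that by (cases e) auto
qed (use that in blast)

lemma positioned_disjoint_flat_flat:
  assumes "a \<in> free_monoid \<Omega> Z" "e \<in> free_monoid \<Omega> Z" "d \<in> free_monoid \<Omega> Z"
  shows "positioned \<Omega> Z (\<lambda>x. a @ x @ e @ v @ d) u (\<lambda>y. a @ u @ e @ y @ d) v"
  using positioned.disjoint[of \<Omega> Z "\<lambda>x y. a @ x @ e @ y @ d" v u] assms
    context_map.flat[of a \<Omega> Z "e @ _ @ d"] context_map.flat[of "a @ _ @ e" \<Omega> Z d] by simp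

text \<open>
  When both occurrences are factors of one and the same list of letters, their relative position is
  read off from the four end points. An overlap with an empty outer or middle part is not an overlap
  in the sense of \<open>positioned\<close>; it degenerates to a disjoint or a nested pair.
\<close>

lemma positioned_flat_flat:
  assumes W: "a \<in> free_monoid \<Omega> Z" "b \<in> free_monoid \<Omega> Z" "c \<in> free_monoid \<Omega> Z" "d \<in> free_monoid \<Omega> Z"
    "u \<in> free_monoid \<Omega> Z" "v \<in> free_monoid \<Omega> Z"
    and eq: "a @ u @ b = c @ v @ d"
    and ac: "length a \<le> length c"
  shows "positioned \<Omega> Z (\<lambda>x. a @ x @ b) u (\<lambda>x. c @ x @ d) v \<or>
    positioned \<Omega> Z (\<lambda>x. c @ x @ d) v (\<lambda>x. a @ x @ b) u"
proof -
  from eq obtain e where e: "c = a @ e" "u @ b = e @ v @ d"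
  proof (cases rule: append_eq_append_cases)
    case (longer e)
    then show ?thesis using that[of "[]"] ac by simp
  qed blast
  have eW: "e \<in> free_monoid \<Omega> Z" using e W by simp
  from e(2) show ?thesis
  proof (cases rule: append_eq_append_cases)
    case disj: (shorter g)
    then show ?thesis using positioned_disjoint_flat_flat[of a \<Omega> Z g d v u] e W by simp
  next
    case meet: (longer g)
    have gW: "g \<in> free_monoid \<Omega> Z" using meet W by simp
    from meet(2) show ?thesis
    proof (cases rule: append_eq_append_cases)
      case incl: (shorter h)
      then have "positioned \<Omega> Z (\<lambda>x. c @ x @ d) v (\<lambda>x. a @ x @ b) u"
        using positioned.inside[OF context_map.flat[of a \<Omega> Z b] context_map.flat[of e \<Omega> Z h], of v] e W meet eW
        by simp
      then show ?thesis by simp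
    next
      case over: (longer h)
      have hW: "h \<in> free_monoid \<Omega> Z" using over W by simp
      consider "g = []" | "e = []" | "h = []" | "g \<noteq> []" "e \<noteq> []" "h \<noteq> []" by blast
      then show ?thesis
      proof cases
        case 1
        then show ?thesis using positioned_disjoint_flat_flat[of a \<Omega> Z "[]" d v u] e W meet over by simp
      next
        case 2
        then show ?thesis
          using positioned.inside[OF context_map.flat[of a \<Omega> Z d] context_map.flat[of "[]" \<Omega> Z h], of u]
            e W meet over by simp
      next
        case 3
        then show ?thesis
          using positioned.inside[OF context_map.flat[of a \<Omega> Z d] context_map.flat[of e \<Omega> Z "[]"], of v]
            e W meet over by simp
      next
        case 4
        then show ?thesis
          using positioned.overlap[OF context_map.flat[of a \<Omega> Z d], of e g h] e W meet over eW gW hW by simp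
      qed
    qed
  qed
qed

text \<open>
  An operator letter is indivisible: an occurrence of \<open>v\<close> inside it is disjoint from every factor of the
  surrounding list that does not contain the letter, and lies within every factor that does.
\<close>

lemma positioned_flat_nested:
  assumes W: "a \<in> free_monoid \<Omega> Z" "b \<in> free_monoid \<Omega> Z" "c \<in> free_monoid \<Omega> Z" "d \<in> free_monoid \<Omega> Z"
    "u \<in> free_monoid \<Omega> Z" "v \<in> free_monoid \<Omega> Z" "\<tau> \<in> \<Omega>" and g: "context_map \<Omega> Z g"
    and eq: "a @ u @ b = c @ Op \<tau> (g v) # d"
  shows "positioned \<Omega> Z (\<lambda>x. a @ x @ b) u (\<lambda>x. c @ Op \<tau> (g x) # d) v \<or>
    positioned \<Omega> Z (\<lambda>x. c @ Op \<tau> (g x) # d) v (\<lambda>x. a @ x @ b) u"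
proof -
  have gW: "g y \<in> free_monoid \<Omega> Z" if "y \<in> free_monoid \<Omega> Z" for y
    using context_map_in_free_monoid_iff[OF g] that by simp
  from eq show ?thesis
  proof (cases rule: append_eq_append_Cons_cases)
    case left: (longer e)
    then show ?thesis
      using positioned.disjoint[of \<Omega> Z "\<lambda>y x. c @ Op \<tau> (g y) # e @ x @ b" u v] W gW
        context_map.nested[OF g, of c "e @ _ @ b" \<tau>] context_map.flat[of "c @ Op \<tau> (g _) # e" \<Omega> Z b]
      by simp
  next
    case right: (shorter e)
    from right(2) show ?thesis
    proof (cases rule: append_eq_append_Cons_cases)
      case after: (shorter h)
      then show ?thesis
        using positioned.disjoint[of \<Omega> Z "\<lambda>x y. a @ x @ h @ Op \<tau> (g y) # d" v u] W gW right
          context_map.flat[of a \<Omega> Z "h @ Op \<tau> (g _) # d"] context_map.nested[OF g, of "a @ _ @ h" d \<tau>]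
        by simp
    next
      case within: (longer h)
      then show ?thesis
        using positioned.inside[OF context_map.flat[of a \<Omega> Z b] context_map.nested[OF g, of e h \<tau>], of v] W right
        by simp
    qed
  qed
qed

lemma positioned_disjoint_nested_nested:
  assumes f: "context_map \<Omega> Z f" and g: "context_map \<Omega> Z g"
    and "a \<in> free_monoid \<Omega> Z" "e \<in> free_monoid \<Omega> Z" "d \<in> free_monoid \<Omega> Z" "\<tau> \<in> \<Omega>" "\<sigma> \<in> \<Omega>"
  shows "positioned \<Omega> Z (\<lambda>x. a @ Op \<tau> (f x) # e @ Op \<sigma> (g v) # d) u
    (\<lambda>y. a @ Op \<tau> (f u) # e @ Op \<sigma> (g y) # d) v"
  using positioned.disjoint[of \<Omega> Z "\<lambda>x y. a @ Op \<tau> (f x) # e @ Op \<sigma> (g y) # d" v u] assms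
    context_map.nested[OF f, of a "e @ Op \<sigma> (g _) # d" \<tau>]
    context_map.nested[OF g, of "a @ Op \<tau> (f _) # e" d \<sigma>]
  by (simp add: context_map_in_free_monoid_iff)

text \<open>
  Both holes are followed down from the root. As long as they lie in the same operator letter the
  situation is carried one level up by \<open>positioned_nested\<close>; once they part, or one of them is at the top
  level, one of the preceding lemmas applies.
\<close>

lemma occurrences_positioned:
  assumes "context_map \<Omega> Z f" "context_map \<Omega> Z g" "u \<in> free_monoid \<Omega> Z" "v \<in> free_monoid \<Omega> Z"
    "f u = g v"
  shows "positioned \<Omega> Z f u g v \<or> positioned \<Omega> Z g v f u"
  using assms
proof (induction arbitrary: g)
  case (flat a b)
  from \<open>context_map \<Omega> Z g\<close> show ?case
  proof cases
    case (flat c d)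
    show ?thesis
    proof (cases "length a \<le> length c")
      case True
      then show ?thesis
        using positioned_flat_flat[of a \<Omega> Z b c d u v] flat \<open>a \<in> _\<close> \<open>b \<in> _\<close>
          \<open>u \<in> _\<close> \<open>v \<in> _\<close> \<open>a @ u @ b = g v\<close> by simp
    next
      case False
      then show ?thesis
        using positioned_flat_flat[of c \<Omega> Z d a b v u] flat \<open>a \<in> _\<close> \<open>b \<in> _\<close>
          \<open>u \<in> _\<close> \<open>v \<in> _\<close> \<open>a @ u @ b = g v\<close> by auto
    qed
  next
    case (nested g' c d \<tau>)
    then show ?thesis
      using positioned_flat_nested[of a \<Omega> Z b c d u v \<tau> g'] \<open>a \<in> _\<close> \<open>b \<in> _\<close>
        \<open>u \<in> _\<close> \<open>v \<in> _\<close> \<open>a @ u @ b = g v\<close> by simp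
  qed
next
  case (nested f a b \<tau>)
  note W = \<open>a \<in> _\<close> \<open>b \<in> _\<close> \<open>u \<in> _\<close> \<open>v \<in> _\<close> \<open>\<tau> \<in> _\<close> and fg = \<open>a @ Op \<tau> (f u) # b = g v\<close>
    and f = \<open>context_map \<Omega> Z f\<close> and IH = nested.IH
  from \<open>context_map \<Omega> Z g\<close> show ?case
  proof cases
    case (flat c d)
    then show ?thesis
      using positioned_flat_nested[of c \<Omega> Z d a b v u \<tau> f] W fg f by auto
  next
    case (nested g' c d \<sigma>)
    with fg have eq: "a @ Op \<tau> (f u) # b = c @ Op \<sigma> (g' v) # d" by simp
    from eq show ?thesis
    proof (cases rule: append_eq_append_Cons_cases)
      case after: (longer e)
      then show ?thesis
        using positioned_disjoint_nested_nested[OF \<open>context_map \<Omega> Z g'\<close> f, of c e b \<sigma> \<tau> u v] nested W by simp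
    next
      case not_after: (shorter e)
      show ?thesis
      proof (cases e)
        case Nil
        with not_after have "a = c" "\<tau> = \<sigma>" "f u = g' v" "b = d" by auto
        then show ?thesis
          using IH[of g'] nested W positioned_nested[of \<Omega> Z _ _ _ _ a b \<tau>] by blast
      next
        case (Cons l e')
        then show ?thesis
          using positioned_disjoint_nested_nested[OF f \<open>context_map \<Omega> Z g'\<close>, of a e' d \<tau> \<sigma> v u] not_after nested W
          by simp
      qed
    qed
  qed
qed

section \<open>Linear extension of maps on words\<close>

lemma lookup_scale [simp]: "Poly_Mapping.lookup (scale c a) w = c * Poly_Mapping.lookup a w"
  by (simp add: scale_def Poly_Mapping.map.rep_eq when_def)

lemma keys_scale: "Poly_Mapping.keys (scale c a) \<subseteq> Poly_Mapping.keys a"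
  by (auto simp: in_keys_iff)

lemma scale_single [simp]: "scale c (Poly_Mapping.single w d) = Poly_Mapping.single w (c * d)"
  by (rule poly_mapping_eqI) (simp add: lookup_single when_def)

global_interpretation lincomb:
  vector_space "scale :: 'k \<Rightarrow> ('z, 'o, 'k::field_char_0) lincomb \<Rightarrow> ('z, 'o, 'k) lincomb"
  by unfold_locales (auto intro!: poly_mapping_eqI simp: lookup_add algebra_simps)

lemma lincomb_eq_sum_monom: "(\<Sum>w\<in>Poly_Mapping.keys a. scale (Poly_Mapping.lookup a w) (monom w)) = a"
  by (rule poly_mapping_eqI)
    (auto simp: lookup_sum lookup_single when_def in_keys_iff sum.If_cases Int_def if_distrib[of "\<lambda>x. x = _"] cong: if_cong)

text \<open>
  The linear extension of a map on words; it covers substitution into a context as well as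
  multiplication by a word on either side.
\<close>

definition lin_ext :: "(('z, 'o) word \<Rightarrow> ('y, 'o) word) \<Rightarrow> ('z, 'o, 'k::field_char_0) lincomb
    \<Rightarrow> ('y, 'o, 'k) lincomb" where
  "lin_ext f a = (\<Sum>w\<in>Poly_Mapping.keys a. scale (Poly_Mapping.lookup a w) (monom (f w)))"

lemma plug_lin_eq_lin_ext: "plug_lin q = lin_ext (plug q)"
  by (simp add: fun_eq_iff plug_lin_def lin_ext_def)

text \<open>
  Writing the sum over a common superset of the supports is what makes additivity visible.
\<close>

lemma lin_ext_superset:
  assumes "finite A" "Poly_Mapping.keys a \<subseteq> A"
  shows "lin_ext f a = (\<Sum>w\<in>A. scale (Poly_Mapping.lookup a w) (monom (f w)))"
  unfolding lin_ext_def using assms by (intro sum.mono_neutral_left) (auto simp: in_keys_iff)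

lemma lin_ext_zero [simp]: "lin_ext f 0 = 0"
  by (simp add: lin_ext_def)

lemma lin_ext_monom [simp]: "lin_ext f (monom w) = monom (f w)"
  by (simp add: lin_ext_def)

lemma lin_ext_add: "lin_ext f (a + b) = lin_ext f a + lin_ext f b"
proof -
  let ?A = "Poly_Mapping.keys a \<union> Poly_Mapping.keys b"
  have "lin_ext f c = (\<Sum>w\<in>?A. scale (Poly_Mapping.lookup c w) (monom (f w)))"
    if "c \<in> {a, b, a + b}" for c
    using that Poly_Mapping.keys_add[of a b] by (intro lin_ext_superset) auto
  then show ?thesis by (simp add: lookup_add single_add sum.distrib)
qed

lemma lin_ext_scale: "lin_ext f (scale c a) = scale c (lin_ext f a)"
  by (simp add: lin_ext_superset[OF _ keys_scale] lin_ext_def[of f a] lincomb.scale_sum_right)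

lemma lin_ext_minus: "lin_ext f (a - b) = lin_ext f a - lin_ext f b"
  using lin_ext_add[of f "a - b" b] by (simp add: algebra_simps)

lemma lin_ext_compose: "lin_ext g (lin_ext f a) = lin_ext (\<lambda>w. g (f w)) a"
proof -
  have "lin_ext g (\<Sum>w\<in>A. scale (Poly_Mapping.lookup a w) (monom (f w))) =
    (\<Sum>w\<in>A. scale (Poly_Mapping.lookup a w) (monom (g (f w))))" if "finite A" for A
    using that by (induction A) (simp_all add: lin_ext_add lin_ext_scale del: scale_single)
  then show ?thesis by (simp add: lin_ext_def)
qed

lemma keys_lin_ext: "Poly_Mapping.keys (lin_ext f a) \<subseteq> f ` Poly_Mapping.keys a"
proof -
  have "Poly_Mapping.keys (lin_ext f a) \<subseteq>
      (\<Union>w\<in>Poly_Mapping.keys a. Poly_Mapping.keys (scale (Poly_Mapping.lookup a w) (monom (f w))))"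
    unfolding lin_ext_def by (rule Poly_Mapping.keys_sum)
  also have "\<dots> \<subseteq> f ` Poly_Mapping.keys a" by auto
  finally show ?thesis .
qed

lemma mult_monom_right: "Defs.mult a (monom w) = lin_ext (\<lambda>x. x @ w) a"
  by (simp add: Defs.mult_def lin_ext_def)

lemma mult_monom_left: "Defs.mult (monom w) a = lin_ext (\<lambda>x. w @ x) a"
  by (simp add: Defs.mult_def lin_ext_def)

section \<open>Polygraphs with a compatible monomial order\<close>

locale ordered_polygraph =
  fixes \<Omega> :: "'o set" and X :: "('z, 'o, 'k::field_char_0, 'r) polygraph"
    and prec :: "('z, 'o) word \<Rightarrow> ('z, 'o) word \<Rightarrow> bool" (infix "\<prec>" 50)
  assumes left_monomial: "left_monomial_polygraph \<Omega> X"
    and order: "monomial_order \<Omega> (gens X) prec"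
    and compatible: "compatible_order X prec"
begin

abbreviation "words \<equiv> free_monoid \<Omega> (gens X)"
abbreviation "ctx \<equiv> context_map \<Omega> (gens X)"
abbreviation "relator \<alpha> \<equiv> monom (src X \<alpha>) - tgt X \<alpha>"

lemma prec_irrefl: "u \<in> words \<Longrightarrow> \<not> u \<prec> u"
  using order by (auto simp: monomial_order_def irreflp_on_def)

lemma prec_trans: "u \<prec> v \<Longrightarrow> v \<prec> w \<Longrightarrow> u \<in> words \<Longrightarrow> v \<in> words \<Longrightarrow> w \<in> words \<Longrightarrow> u \<prec> w"
  using order by (auto simp: monomial_order_def dest: transp_onD)

lemma prec_total: "u \<in> words \<Longrightarrow> v \<in> words \<Longrightarrow> u \<prec> v \<or> u = v \<or> v \<prec> u"
  using order by (auto simp: monomial_order_def totalp_on_def)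

lemma prec_wf: "wfp_on words prec"
  using order by (auto simp: monomial_order_def)

lemma ctx_words: "ctx f \<Longrightarrow> f u \<in> words \<longleftrightarrow> u \<in> words"
  by (rule context_map_in_free_monoid_iff)

lemma ctx_mono: "ctx f \<Longrightarrow> u \<in> words \<Longrightarrow> v \<in> words \<Longrightarrow> u \<prec> v \<Longrightarrow> f u \<prec> f v"
  using order context_map_imp_plug[of \<Omega> "gens X" f] by (auto simp: monomial_order_def)

lemma src_words: "\<alpha> \<in> rules X \<Longrightarrow> src X \<alpha> \<in> words"
  using left_monomial by (auto simp: left_monomial_polygraph_def)

lemma tgt_words: "\<alpha> \<in> rules X \<Longrightarrow> Poly_Mapping.keys (tgt X \<alpha>) \<subseteq> words"
  using left_monomial by (auto simp: left_monomial_polygraph_def free_algebra_def)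

lemma tgt_prec: "\<alpha> \<in> rules X \<Longrightarrow> v \<in> Poly_Mapping.keys (tgt X \<alpha>) \<Longrightarrow> v \<prec> src X \<alpha>"
  using compatible by (auto simp: compatible_order_def)

lemma keys_ctx_tgt:
  assumes "\<alpha> \<in> rules X" "ctx f"
  shows "Poly_Mapping.keys (lin_ext f (tgt X \<alpha>)) \<subseteq> {w \<in> words. w \<prec> f (src X \<alpha>)}"
  using keys_lin_ext[of f "tgt X \<alpha>"] tgt_words[OF assms(1)] tgt_prec[OF assms(1)]
    src_words[OF assms(1)] ctx_words[OF assms(2)] ctx_mono[OF assms(2)] by blast

text \<open>
  This links the leading monomials in the notion of triviality to the sources of rules.
\<close>

lemma leading_monomial_relator:
  assumes "\<alpha> \<in> rules X"
  shows "leading_monomial prec (relator \<alpha>) = src X \<alpha>"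
proof -
  have src: "src X \<alpha> \<notin> Poly_Mapping.keys (tgt X \<alpha>)"
    using left_monomial assms by (auto simp: left_monomial_polygraph_def)
  have keys: "Poly_Mapping.keys (relator \<alpha>) = insert (src X \<alpha>) (Poly_Mapping.keys (tgt X \<alpha>))"
    using src by (auto simp: in_keys_iff lookup_minus lookup_single when_def split: if_splits)
  show ?thesis unfolding leading_monomial_def keys
  proof (rule the_equality)
    show "src X \<alpha> \<in> insert (src X \<alpha>) (Poly_Mapping.keys (tgt X \<alpha>)) \<and>
      (\<forall>v\<in>insert (src X \<alpha>) (Poly_Mapping.keys (tgt X \<alpha>)). v \<noteq> src X \<alpha> \<longrightarrow> v \<prec> src X \<alpha>)"
      using tgt_prec[OF assms] by auto
  next
    fix u
    assume u: "u \<in> insert (src X \<alpha>) (Poly_Mapping.keys (tgt X \<alpha>)) \<and>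
      (\<forall>v\<in>insert (src X \<alpha>) (Poly_Mapping.keys (tgt X \<alpha>)). v \<noteq> u \<longrightarrow> v \<prec> u)"
    show "u = src X \<alpha>"
    proof (rule ccontr)
      assume "u \<noteq> src X \<alpha>"
      with u have "src X \<alpha> \<prec> u" "u \<prec> src X \<alpha>" "u \<in> words"
        using tgt_prec[OF assms] tgt_words[OF assms] by auto
      then show False using prec_trans prec_irrefl src_words[OF assms] by blast
    qed
  qed
qed

section \<open>Rewriting steps and termination\<close>

lemma rewriting_stepE:
  assumes "rewriting_step \<Omega> X a b"
  obtains k \<alpha> f c where "k \<noteq> 0" "\<alpha> \<in> rules X" "ctx f" "c \<in> free_algebra \<Omega> (gens X)"
    "f (src X \<alpha>) \<notin> Poly_Mapping.keys c" "a = scale k (monom (f (src X \<alpha>))) + c"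
    "b = scale k (lin_ext f (tgt X \<alpha>)) + c"
  using assms unfolding rewriting_step_def plug_lin_eq_lin_ext using context_map_plug by blast

text \<open>
  Outside the free monoid nothing is known about \<open>\<prec>\<close>; the restriction makes it well-founded on the
  whole type.
\<close>

definition word_less :: "('z, 'o) word \<Rightarrow> ('z, 'o) word \<Rightarrow> bool" where
  "word_less u v \<longleftrightarrow> u \<in> words \<and> v \<in> words \<and> u \<prec> v"

lemma wfp_word_less: "wfp word_less"
  unfolding wfp_iff_ex_minimal
proof (intro allI impI)
  fix B :: "('z, 'o) word set" assume "B \<noteq> {}"
  show "\<exists>z\<in>B. \<forall>y. word_less y z \<longrightarrow> y \<notin> B"
  proof (cases "B \<inter> words = {}")
    case True
    then show ?thesis using \<open>B \<noteq> {}\<close> by (auto simp: word_less_def)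
  next
    case False
    with prec_wf obtain z where "z \<in> B \<inter> words" "\<forall>y. y \<prec> z \<longrightarrow> y \<notin> B \<inter> words"
      unfolding wfp_on_iff_ex_minimal by (meson inf_le2)
    then show ?thesis by (auto simp: word_less_def)
  qed
qed

text \<open>
  A step removes the word \<open>f (src X \<alpha>)\<close> from the support and adds only smaller words to it, so the
  support decreases in the multiset extension of the order.
\<close>

lemma rewriting_step_decreases:
  assumes "rewriting_step \<Omega> X a b"
  shows "multp word_less (mset_set (Poly_Mapping.keys b)) (mset_set (Poly_Mapping.keys a))"
  using assms
proof (rule rewriting_stepE)
  fix k \<alpha> f c
  assume k: "k \<noteq> 0" and \<alpha>: "\<alpha> \<in> rules X" and f: "ctx f"
    and c: "c \<in> free_algebra \<Omega> (gens X)" "f (src X \<alpha>) \<notin> Poly_Mapping.keys c"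
    and a: "a = scale k (monom (f (src X \<alpha>))) + c" and b: "b = scale k (lin_ext f (tgt X \<alpha>)) + c"
  let ?m = "f (src X \<alpha>)" and ?A = "Poly_Mapping.keys a" and ?B = "Poly_Mapping.keys b"
  have m: "?m \<in> words" using ctx_words[OF f] src_words[OF \<alpha>] by simp
  have "w \<in> ?A \<longleftrightarrow> w = ?m \<or> w \<in> Poly_Mapping.keys c" for w
    using k c(2) unfolding a by (cases "w = ?m") (simp_all add: in_keys_iff lookup_add lookup_single)
  then have keys_a: "?A = insert ?m (Poly_Mapping.keys c)" by blast
  have keys_b: "?B \<subseteq> {w \<in> words. w \<prec> ?m} \<union> Poly_Mapping.keys c"
    unfolding b using Poly_Mapping.keys_add[of "scale k (lin_ext f (tgt X \<alpha>))" c]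
      keys_scale[of k "lin_ext f (tgt X \<alpha>)"] keys_ctx_tgt[OF \<alpha> f] by blast
  have m_b: "?m \<notin> ?B" using keys_b prec_irrefl[OF m] c(2) by blast
  have "multp word_less (mset_set (?A \<inter> ?B) + mset_set (?B - ?A)) (mset_set (?A \<inter> ?B) + mset_set (?A - ?B))"
  proof (rule one_step_implies_multp)
    show "mset_set (?A - ?B) \<noteq> {#}" using keys_a m_b by (auto simp: mset_set_empty_iff)
    show "\<forall>k\<in>#mset_set (?B - ?A). \<exists>j\<in>#mset_set (?A - ?B). word_less k j"
      using keys_a keys_b m_b m by (auto simp: word_less_def)
  qed
  moreover have "mset_set (?A \<inter> ?B) + mset_set (?B - ?A) = mset_set ?B"
    by (subst mset_set_Union[symmetric]) (auto intro: arg_cong[where f = mset_set])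
  moreover have "mset_set (?A \<inter> ?B) + mset_set (?A - ?B) = mset_set ?A"
    by (subst mset_set_Union[symmetric]) (auto intro: arg_cong[where f = mset_set])
  ultimately show ?thesis by simp
qed

lemma wfp_rewriting: "wfp (\<lambda>b a. rewriting_step \<Omega> X a b)"
proof (rule wfp_subset)
  show "wfp (\<lambda>b a. multp word_less (mset_set (Poly_Mapping.keys b)) (mset_set (Poly_Mapping.keys a)))"
    using wfp_multp[OF wfp_word_less] by (rule wfp_if_convertible_to_wfp) 
qed (auto intro: rewriting_step_decreases)

lemma terminating: "terminating \<Omega> X"
proof -
  have "False" if "\<forall>n. rewriting_step \<Omega> X (f n) (f (Suc n))" for f
    using wfp_rewriting that unfolding wfp_def wf_iff_no_infinite_down_chain by auto
  then show ?thesis unfolding terminating_def by blast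
qed

section \<open>The span of the relations\<close>

text \<open>
  The span of the elements \<open>q|\<^sub>s\<close>, \<open>s\<close> the difference of source and target of a rule, whose leading
  monomial satisfies \<open>P\<close>. For the constant predicate this is the ideal with operators generated by the
  rules; for \<open>\<lambda>w. w \<prec> r\<close> it consists of the elements trivial modulo \<open>(\<partial>(X\<^sub>1), r)\<close>.
\<close>

definition relations :: "(('z, 'o) word \<Rightarrow> bool) \<Rightarrow> ('z, 'o, 'k) lincomb set" where
  "relations P = lincomb.span {lin_ext f (relator \<alpha>) | f \<alpha>. ctx f \<and> \<alpha> \<in> rules X \<and> P (f (src X \<alpha>))}"

lemma relator_in_relations:
  "ctx f \<Longrightarrow> \<alpha> \<in> rules X \<Longrightarrow> P (f (src X \<alpha>)) \<Longrightarrow> lin_ext f (relator \<alpha>) \<in> relations P"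
  unfolding relations_def by (rule lincomb.span_base) auto

lemma relations_add: "x \<in> relations P \<Longrightarrow> y \<in> relations P \<Longrightarrow> x + y \<in> relations P"
  unfolding relations_def by (rule lincomb.span_add)

lemma relations_diff: "x \<in> relations P \<Longrightarrow> y \<in> relations P \<Longrightarrow> x - y \<in> relations P"
  unfolding relations_def by (rule lincomb.span_diff)

lemma relations_scale: "x \<in> relations P \<Longrightarrow> scale c x \<in> relations P"
  unfolding relations_def by (rule lincomb.span_scale)

lemma relations_sum: "(\<And>i. i \<in> I \<Longrightarrow> x i \<in> relations P) \<Longrightarrow> sum x I \<in> relations P"
  unfolding relations_def by (rule lincomb.span_sum)

lemma relations_zero [simp]: "0 \<in> relations P"
  unfolding relations_def by (rule lincomb.span_zero)

lemma relations_induct [consumes 1, case_names zero step]: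
  assumes "x \<in> relations P" "Q 0"
    and "\<And>c f \<alpha> y. ctx f \<Longrightarrow> \<alpha> \<in> rules X \<Longrightarrow> P (f (src X \<alpha>)) \<Longrightarrow> y \<in> relations P \<Longrightarrow> Q y \<Longrightarrow>
      Q (scale c (lin_ext f (relator \<alpha>)) + y)"
  shows "Q x"
proof -
  have "x \<in> relations P \<and> Q x"
    using assms(1)[unfolded relations_def]
  proof (induction rule: lincomb.span_induct_alt)
    case base
    then show ?case using assms(2) by simp
  next
    case (step c x y)
    then obtain f \<alpha> where "ctx f" "\<alpha> \<in> rules X" "P (f (src X \<alpha>))" and x: "x = lin_ext f (relator \<alpha>)"
      by blast
    with step(2) show ?case
      unfolding x by (blast intro: assms(3) relations_add relations_scale relator_in_relations)
  qed
  then show ?thesis by simp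
qed

lemma relations_mono:
  assumes "x \<in> relations P" "\<And>w. w \<in> words \<Longrightarrow> P w \<Longrightarrow> Q w"
  shows "x \<in> relations Q"
  using assms(1)
proof (induction rule: relations_induct)
  case (step c f \<alpha> y)
  then show ?case
    by (intro relations_add relations_scale relator_in_relations assms(2)) (simp_all add: ctx_words src_words)
qed simp

lemma lin_ext_relations:
  assumes "x \<in> relations P" "ctx g" "\<And>w. w \<in> words \<Longrightarrow> P w \<Longrightarrow> Q (g w)"
  shows "lin_ext g x \<in> relations Q"
  using assms(1)
proof (induction rule: relations_induct)
  case (step c f \<alpha> y)
  then have "lin_ext (\<lambda>w. g (f w)) (relator \<alpha>) \<in> relations Q"
    using relator_in_relations[OF context_map_compose[OF assms(2) step(1)] step(2), of Q]
    by (simp add: assms(3) ctx_words src_words)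
  with step show ?case
    by (simp add: lin_ext_add lin_ext_scale lin_ext_compose relations_add relations_scale)
qed simp

lemma trivial_modulo_relations:
  assumes "trivial_modulo \<Omega> (gens X) prec (boundary X) r c"
  shows "c \<in> relations (\<lambda>w. w \<prec> r)"
proof -
  obtain n :: nat and l q s where i: "\<And>i. i < n \<Longrightarrow> q i \<in> contexts \<Omega> (gens X) \<and> s i \<in> boundary X \<and>
      plug (q i) (leading_monomial prec (s i)) \<prec> r"
    and c: "c = (\<Sum>i<n. scale (l i) (plug_lin (q i) (s i)))"
    using assms unfolding trivial_modulo_def by blast
  show ?thesis unfolding c
  proof (intro relations_sum relations_scale)
    fix j assume "j \<in> {..<n}"
    then obtain \<alpha> where "\<alpha> \<in> rules X" "s j = relator \<alpha>"
      using i[of j] by (auto simp: boundary_def)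
    then show "plug_lin (q j) (s j) \<in> relations (\<lambda>w. w \<prec> r)"
      using i[of j] \<open>j \<in> _\<close> leading_monomial_relator[of \<alpha>]
      by (auto simp: plug_lin_eq_lin_ext intro!: relator_in_relations context_map_plug)
  qed
qed

lemma rewriting_step_relations:
  assumes "rewriting_step \<Omega> X a b"
  shows "a - b \<in> relations (\<lambda>w. True)"
  using assms
proof (rule rewriting_stepE)
  fix k \<alpha> f c
  assume *: "\<alpha> \<in> rules X" "ctx f" "a = scale k (monom (f (src X \<alpha>))) + c" "b = scale k (lin_ext f (tgt X \<alpha>)) + c"
  have "a - b = scale k (lin_ext f (relator \<alpha>))"
    by (simp add: *(3,4) lin_ext_minus lincomb.scale_right_diff_distrib del: scale_single)
  then show ?thesis using *(1,2) by (simp add: relations_scale relator_in_relations)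
qed

lemma rewriting_relations: "(rewriting_step \<Omega> X)\<^sup>*\<^sup>* a b \<Longrightarrow> a - b \<in> relations (\<lambda>w. True)"
proof (induction rule: rtranclp_induct)
  case (step b c)
  then show ?case using relations_add[OF step.IH rewriting_step_relations[OF step(2)]] by simp
qed simp

lemma rewriting_free_algebra:
  assumes "(rewriting_step \<Omega> X)\<^sup>*\<^sup>* a b" "a \<in> free_algebra \<Omega> (gens X)"
  shows "b \<in> free_algebra \<Omega> (gens X)"
  using assms
proof (induction rule: rtranclp_induct)
  case (step b b')
  from step(2) show ?case
  proof (rule rewriting_stepE)
    fix k \<alpha> f c
    assume "\<alpha> \<in> rules X" "ctx f" "c \<in> free_algebra \<Omega> (gens X)" "b' = scale k (lin_ext f (tgt X \<alpha>)) + c"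
    then show ?thesis
      using keys_ctx_tgt[of \<alpha> f] keys_scale[of k "lin_ext f (tgt X \<alpha>)"]
        Poly_Mapping.keys_add[of "scale k (lin_ext f (tgt X \<alpha>))" c]
      unfolding free_algebra_def by blast
  qed
qed

section \<open>Normal forms\<close>

text \<open>
  Since the source of a rule is a word, an element admits no rewriting step exactly when no word of its
  support is reducible.
\<close>

definition reducible :: "('z, 'o) word \<Rightarrow> bool" where
  "reducible w \<longleftrightarrow> (\<exists>f \<alpha>. ctx f \<and> \<alpha> \<in> rules X \<and> w = f (src X \<alpha>))"

lemma reducible_rewrites:
  assumes "a \<in> free_algebra \<Omega> (gens X)" "w \<in> Poly_Mapping.keys a" "reducible w"
  obtains b where "rewriting_step \<Omega> X a b"
proof -
  obtain f \<alpha> where "ctx f" and \<alpha>: "\<alpha> \<in> rules X" and w: "w = f (src X \<alpha>)"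
    using assms(3) unfolding reducible_def by blast
  then obtain q where q: "q \<in> contexts \<Omega> (gens X)" "f = plug q" using context_map_imp_plug by blast
  let ?k = "Poly_Mapping.lookup a w" and ?c = "a - Poly_Mapping.single w (Poly_Mapping.lookup a w)"
  have "?k \<noteq> 0" using assms(2) by (simp add: in_keys_iff)
  moreover have "Poly_Mapping.keys ?c \<subseteq> Poly_Mapping.keys a - {w}"
    by (auto simp: in_keys_iff lookup_minus lookup_single when_def split: if_splits)
  moreover have "a = scale ?k (monom w) + ?c" by simp
  ultimately have "rewriting_step \<Omega> X a (scale ?k (plug_lin q (tgt X \<alpha>)) + ?c)"
    unfolding rewriting_step_def using assms(1) \<alpha> q w
    by (intro exI[of _ ?k] exI[of _ \<alpha>] exI[of _ q] exI[of _ ?c]) (auto simp: free_algebra_def)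
  then show ?thesis using that by blast
qed

lemma normal_form_exists:
  assumes "a \<in> free_algebra \<Omega> (gens X)"
  shows "\<exists>b. (rewriting_step \<Omega> X)\<^sup>*\<^sup>* a b \<and> b \<in> free_algebra \<Omega> (gens X) \<and>
    (\<forall>w\<in>Poly_Mapping.keys b. \<not> reducible w)"
  using assms
proof (induction a rule: wfp_induct_rule[OF wfp_rewriting])
  case (1 a)
  show ?case
  proof (cases "\<forall>w\<in>Poly_Mapping.keys a. \<not> reducible w")
    case True
    then show ?thesis using 1(2) by blast
  next
    case False
    then obtain b where b: "rewriting_step \<Omega> X a b" using reducible_rewrites[OF 1(2)] by blast
    then have "b \<in> free_algebra \<Omega> (gens X)" using rewriting_free_algebra 1(2) by blast
    then show ?thesis using 1(1)[OF b] converse_rtranclp_into_rtranclp[of "rewriting_step \<Omega> X", OF b] by blast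
  qed
qed

section \<open>Rules with empty source\<close>

text \<open>
  If some word were below the empty word, let \<open>m\<close> be the least such. Then \<open>m @ m\<close> is below \<open>m\<close> by
  monotonicity in the context \<open>m \<box>\<close>, contradicting minimality.
\<close>

lemma not_prec_Nil: "v \<in> words \<Longrightarrow> \<not> v \<prec> []"
proof
  assume v: "v \<in> words" "v \<prec> []"
  then obtain m where m: "m \<in> {w \<in> words. w \<prec> []}" "\<forall>y. y \<prec> m \<longrightarrow> y \<notin> {w \<in> words. w \<prec> []}"
    using prec_wf[unfolded wfp_on_iff_ex_minimal, rule_format, of "{w \<in> words. w \<prec> []}"] by auto
  then have "m @ m \<prec> m" using ctx_mono[OF context_map_append_left[of m], of m "[]"] by simp
  moreover from this have "m @ m \<prec> []" using m prec_trans[of "m @ m" m "[]"] by simp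
  ultimately show False using m by auto
qed

lemma tgt_empty_src:
  assumes "\<alpha> \<in> rules X" "src X \<alpha> = []"
  shows "tgt X \<alpha> = 0"
  using tgt_prec[OF assms(1)] tgt_words[OF assms(1)] not_prec_Nil assms(2)
  by (metis Poly_Mapping.keys_eq_empty equals0I subsetD)

text \<open>
  A rule with empty source has target \<open>0\<close> and can be applied in every word, with the hole after the
  last letter. So every word is itself a relation.
\<close>

lemma empty_src_relations:
  assumes "\<alpha> \<in> rules X" "src X \<alpha> = []" "\<And>w. w \<in> Poly_Mapping.keys a \<Longrightarrow> w \<in> words \<and> P w"
  shows "a \<in> relations P"
proof -
  have "monom w \<in> relations P" if "w \<in> Poly_Mapping.keys a" for w
    using relator_in_relations[OF context_map_append_left assms(1), of w P] that assms(3)[OF that]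
    by (simp add: assms(2) tgt_empty_src[OF assms(1,2)])
  then show ?thesis
    by (subst lincomb_eq_sum_monom[symmetric]) (intro relations_sum relations_scale)
qed

end

section \<open>Branchings under the Groebner-Shirshov condition\<close>

locale groebner_polygraph = ordered_polygraph +
  assumes groebner: "groebner_shirshov_basis \<Omega> X prec (boundary X)"
begin

text \<open>
  Disjoint occurrences give no critical branching, but their branching closes by rewriting the other
  occurrence on each side: both \<open>F (t \<alpha>) (s \<beta>)\<close> and \<open>F (s \<alpha>) (t \<beta>)\<close> differ from \<open>F (t \<alpha>) (t \<beta>)\<close> by
  relations whose leading monomials are \<open>F x (s \<beta>)\<close> with \<open>x\<close> in the support of \<open>t \<alpha>\<close>, respectively
  \<open>F (s \<alpha>) y\<close> with \<open>y\<close> in the support of \<open>t \<beta>\<close>. These are below \<open>F (s \<alpha>) (s \<beta>)\<close>.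
\<close>

lemma disjoint_occurrences_relations:
  assumes \<alpha>: "\<alpha> \<in> rules X" and \<beta>: "\<beta> \<in> rules X"
    and left: "\<And>y. y \<in> words \<Longrightarrow> ctx (\<lambda>x. F x y)" and right: "\<And>x. x \<in> words \<Longrightarrow> ctx (F x)"
  shows "lin_ext (\<lambda>x. F x (src X \<beta>)) (tgt X \<alpha>) - lin_ext (F (src X \<alpha>)) (tgt X \<beta>)
    \<in> relations (\<lambda>w. w \<prec> F (src X \<alpha>) (src X \<beta>))"
proof -
  let ?u = "src X \<alpha>" and ?v = "src X \<beta>" and ?a = "tgt X \<alpha>" and ?b = "tgt X \<beta>"
  let ?P = "\<lambda>w. w \<prec> F ?u ?v"
  \<comment> \<open>\<open>?E\<close> is \<open>F (t \<alpha>) (s \<beta>) - F (t \<alpha>) (t \<beta>)\<close> and \<open>?E'\<close> is \<open>F (s \<alpha>) (t \<beta>) - F (t \<alpha>) (t \<beta>)\<close>, expanded linearly.\<close>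
  let ?E = "\<Sum>x\<in>Poly_Mapping.keys ?a. scale (Poly_Mapping.lookup ?a x) (lin_ext (F x) (relator \<beta>))"
  let ?E' = "\<Sum>y\<in>Poly_Mapping.keys ?b. scale (Poly_Mapping.lookup ?b y) (lin_ext (\<lambda>x. F x y) (relator \<alpha>))"
  have "?E \<in> relations ?P"
    using tgt_words[OF \<alpha>] tgt_prec[OF \<alpha>]
    by (intro relations_sum relations_scale relator_in_relations \<beta> right
        ctx_mono[OF left[OF src_words[OF \<beta>]]] src_words[OF \<alpha>]) auto
  moreover have "?E' \<in> relations ?P"
    using tgt_words[OF \<beta>] tgt_prec[OF \<beta>]
    by (intro relations_sum relations_scale relator_in_relations \<alpha> left
        ctx_mono[OF right[OF src_words[OF \<alpha>]]] src_words[OF \<beta>]) auto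
  moreover have "(\<Sum>x\<in>Poly_Mapping.keys ?a. scale (Poly_Mapping.lookup ?a x) (lin_ext (F x) ?b)) =
    (\<Sum>y\<in>Poly_Mapping.keys ?b. scale (Poly_Mapping.lookup ?b y) (lin_ext (\<lambda>x. F x y) ?a))"
    unfolding lin_ext_def lincomb.scale_sum_right
    by (subst sum.swap) (simp add: mult.commute)
  then have "lin_ext (\<lambda>x. F x ?v) ?a - lin_ext (F ?u) ?b = ?E - ?E'"
    unfolding lin_ext_minus lincomb.scale_right_diff_distrib sum_subtractf lin_ext_monom
    by (simp add: lin_ext_def[of "\<lambda>x. F x ?v"] lin_ext_def[of "F ?u"])
  ultimately show ?thesis using relations_diff by simp
qed

text \<open>
  In the first two positions the branching is a critical one placed in the context \<open>g\<close>, respectively \<open>h\<close>.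
  Triviality passes to contexts because the order is monotone. The only nested pair that is not a
  critical branching is a rule with itself at the same place, where the difference vanishes.
\<close>

lemma positioned_relations:
  assumes \<alpha>: "\<alpha> \<in> rules X" and \<beta>: "\<beta> \<in> rules X" and ne: "src X \<alpha> \<noteq> []"
    and pos: "positioned \<Omega> (gens X) f (src X \<alpha>) g (src X \<beta>)"
  shows "lin_ext f (tgt X \<alpha>) - lin_ext g (tgt X \<beta>) \<in> relations (\<lambda>w. w \<prec> g (src X \<beta>))"
  using pos
proof cases
  case (inside h)
  then obtain q where q: "q \<in> contexts \<Omega> (gens X)" "h = plug q" using context_map_imp_plug by blast
  show ?thesis
  proof (cases "q = hole \<and> \<alpha> = \<beta>")
    case True
    then have "h = (\<lambda>x. x)" using q by (simp add: fun_eq_iff)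
    then show ?thesis using inside(1) True by simp
  next
    case False
    then have "inclusion_branching \<Omega> X \<alpha> \<beta> q (src X \<alpha>)"
      unfolding inclusion_branching_def using \<alpha> \<beta> q src_words[OF \<alpha>] inside(2) ne by auto
    then have "trivial_modulo \<Omega> (gens X) prec (boundary X) (src X \<beta>) (plug_lin q (tgt X \<alpha>) - tgt X \<beta>)"
      using groebner inside(2) q unfolding groebner_shirshov_basis_def by metis
    then have "lin_ext h (tgt X \<alpha>) - tgt X \<beta> \<in> relations (\<lambda>w. w \<prec> src X \<beta>)"
      using trivial_modulo_relations q by (simp add: plug_lin_eq_lin_ext)
    then have "lin_ext g (lin_ext h (tgt X \<alpha>) - tgt X \<beta>) \<in> relations (\<lambda>w. w \<prec> g (src X \<beta>))"
      using inside(3) by (rule lin_ext_relations) (simp add: ctx_mono inside(3) src_words \<beta>)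
    then show ?thesis by (simp add: lin_ext_minus lin_ext_compose inside(1))
  qed
next
  case (overlap h a b c)
  then have "intersection_branching \<Omega> X \<alpha> \<beta> a b c"
    unfolding intersection_branching_def using \<alpha> \<beta> by simp
  then have "trivial_modulo \<Omega> (gens X) prec (boundary X) (a @ b @ c)
      (Defs.mult (tgt X \<alpha>) (monom c) - Defs.mult (monom a) (tgt X \<beta>))"
    using groebner unfolding groebner_shirshov_basis_def by blast
  then have "lin_ext (\<lambda>x. x @ c) (tgt X \<alpha>) - lin_ext (\<lambda>x. a @ x) (tgt X \<beta>) \<in> relations (\<lambda>w. w \<prec> a @ b @ c)"
    using trivial_modulo_relations by (simp add: mult_monom_left mult_monom_right)
  then have "lin_ext h (lin_ext (\<lambda>x. x @ c) (tgt X \<alpha>) - lin_ext (\<lambda>x. a @ x) (tgt X \<beta>))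
      \<in> relations (\<lambda>w. w \<prec> h (a @ b @ c))"
    using overlap(5) by (rule lin_ext_relations) (use overlap in \<open>simp add: ctx_mono\<close>)
  then show ?thesis by (simp add: lin_ext_minus lin_ext_compose overlap(1-4))
next
  case (disjoint F)
  then show ?thesis using disjoint_occurrences_relations[OF \<alpha> \<beta>, of F] by simp
qed

text \<open>
  A rule with an empty source takes part in no critical branching as the included rule, so the
  Groebner-Shirshov condition does not control its position; in its presence every combination of words
  below the common source is trivial by \<open>empty_src_relations\<close>.
\<close>

lemma same_source_relations:
  assumes \<alpha>: "\<alpha> \<in> rules X" and \<beta>: "\<beta> \<in> rules X" and f: "ctx f" and g: "ctx g"
    and eq: "f (src X \<alpha>) = g (src X \<beta>)"
  shows "lin_ext f (tgt X \<alpha>) - lin_ext g (tgt X \<beta>) \<in> relations (\<lambda>w. w \<prec> f (src X \<alpha>))"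
proof (cases "src X \<alpha> = [] \<or> src X \<beta> = []")
  case True
  have "lin_ext f (tgt X \<alpha>) \<in> relations (\<lambda>w. w \<prec> f (src X \<alpha>))"
    using True keys_ctx_tgt[OF \<alpha> f] \<alpha> \<beta> by (blast intro: empty_src_relations)
  moreover have "lin_ext g (tgt X \<beta>) \<in> relations (\<lambda>w. w \<prec> f (src X \<alpha>))"
    using True keys_ctx_tgt[OF \<beta> g] \<alpha> \<beta> unfolding eq by (blast intro: empty_src_relations)
  ultimately show ?thesis by (rule relations_diff)
next
  case False
  from occurrences_positioned[OF f g src_words[OF \<alpha>] src_words[OF \<beta>] eq] show ?thesis
  proof
    assume "positioned \<Omega> (gens X) f (src X \<alpha>) g (src X \<beta>)"
    then show ?thesis using positioned_relations[OF \<alpha> \<beta>, of f g] False eq by simp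
  next
    assume "positioned \<Omega> (gens X) g (src X \<beta>) f (src X \<alpha>)"
    then have "scale (- 1) (lin_ext g (tgt X \<beta>) - lin_ext f (tgt X \<alpha>)) \<in> relations (\<lambda>w. w \<prec> f (src X \<alpha>))"
      using positioned_relations[OF \<beta> \<alpha>, of g f] False by (intro relations_scale) simp
    then show ?thesis by simp
  qed
qed

section \<open>Confluence\<close>

text \<open>
  All words in a relation are bounded by its leading monomial, so none of them can be \<open>r\<close>.
\<close>

lemma relations_below_lookup:
  assumes "x \<in> relations (\<lambda>w. w \<prec> r)" "r \<in> words"
  shows "Poly_Mapping.lookup x r = 0"
  using assms(1)
proof (induction rule: relations_induct)
  case (step c f \<alpha> y)
  have m: "f (src X \<alpha>) \<in> words" using step ctx_words src_words by blast
  have "r \<notin> Poly_Mapping.keys (lin_ext f (tgt X \<alpha>))"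
    using keys_ctx_tgt[OF step(2,1)] step(3) m assms(2) prec_trans prec_irrefl by blast
  moreover have "f (src X \<alpha>) \<noteq> r" using step(3) prec_irrefl assms(2) by blast
  ultimately show ?case
    using step.IH by (simp add: lookup_add lin_ext_minus lookup_minus lookup_single in_keys_iff)
qed simp

text \<open>
  All relations with leading monomial \<open>r\<close> agree modulo the relations with smaller leading monomial, by
  \<open>same_source_relations\<close>. So a combination of relations up to \<open>r\<close> is \<open>k\<close> times a single one of them plus
  smaller relations, and \<open>k\<close> is the coefficient of \<open>r\<close>.
\<close>

lemma relations_peel:
  assumes x: "x \<in> relations (\<lambda>w. w = r \<or> w \<prec> r)" and r: "r \<in> words"
  shows "x \<in> relations (\<lambda>w. w \<prec> r) \<or> r \<in> Poly_Mapping.keys x \<and> reducible r"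
proof (cases "reducible r")
  case False
  from x have "x \<in> relations (\<lambda>w. w \<prec> r)"
  proof (induction rule: relations_induct)
    case (step c f \<alpha> y)
    with False have "f (src X \<alpha>) \<prec> r" unfolding reducible_def by blast
    with step show ?case by (intro relations_add relations_scale relator_in_relations)
  qed simp
  then show ?thesis by simp
next
  case True
  then obtain f0 \<alpha>0 where f0: "ctx f0" "\<alpha>0 \<in> rules X" "f0 (src X \<alpha>0) = r" unfolding reducible_def by blast
  let ?R = "lin_ext f0 (relator \<alpha>0)"
  from x have "\<exists>k. x - scale k ?R \<in> relations (\<lambda>w. w \<prec> r)"
  proof (induction rule: relations_induct)
    case zero
    show ?case by (rule exI[of _ 0]) simp
  next
    case (step c f \<alpha> y)
    then obtain k where k: "y - scale k ?R \<in> relations (\<lambda>w. w \<prec> r)" by blast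
    from step(3) show ?case
    proof
      assume "f (src X \<alpha>) \<prec> r"
      then have "scale c (lin_ext f (relator \<alpha>)) + (y - scale k ?R) \<in> relations (\<lambda>w. w \<prec> r)"
        using step k by (intro relations_add relations_scale relator_in_relations)
      then show ?thesis by (intro exI[of _ k]) (simp add: algebra_simps)
    next
      assume m: "f (src X \<alpha>) = r"
      then have "lin_ext f0 (tgt X \<alpha>0) - lin_ext f (tgt X \<alpha>) \<in> relations (\<lambda>w. w \<prec> r)"
        using same_source_relations[OF f0(2) step(2) f0(1) step(1)] f0 by simp
      then have "lin_ext f (relator \<alpha>) - ?R \<in> relations (\<lambda>w. w \<prec> r)"
        by (simp add: lin_ext_minus m f0)
      then have "scale c (lin_ext f (relator \<alpha>) - ?R) + (y - scale k ?R) \<in> relations (\<lambda>w. w \<prec> r)"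
        using k by (intro relations_add relations_scale)
      then show ?thesis
        by (intro exI[of _ "c + k"])
          (simp add: lincomb.scale_right_diff_distrib lincomb.scale_left_distrib algebra_simps del: scale_single)
    qed
  qed
  then obtain k where k: "x - scale k ?R \<in> relations (\<lambda>w. w \<prec> r)" by blast
  have "r \<notin> Poly_Mapping.keys (lin_ext f0 (tgt X \<alpha>0))"
    using keys_ctx_tgt[OF f0(2,1)] f0(3) prec_irrefl r by blast
  then have "Poly_Mapping.lookup x r = k"
    using relations_below_lookup[OF k r] by (simp add: lookup_minus lin_ext_minus f0 in_keys_iff)
  then show ?thesis using k True by (cases "k = 0") (simp_all add: in_keys_iff)
qed

text \<open>
  Only finitely many relations occur in a given element, and the order is total.
\<close>

lemma relations_bounded:
  assumes "x \<in> relations P"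
  shows "x = 0 \<or> (\<exists>r\<in>words. P r \<and> x \<in> relations (\<lambda>w. w = r \<or> w \<prec> r))"
  using assms
proof (induction rule: relations_induct)
  case (step c f \<alpha> y)
  let ?m = "f (src X \<alpha>)" and ?g = "scale c (lin_ext f (relator \<alpha>))"
  have m: "?m \<in> words" using step ctx_words src_words by blast
  have g: "?g \<in> relations (\<lambda>w. w = ?m \<or> w \<prec> ?m)"
    using step by (intro relations_scale relator_in_relations) auto
  from step.IH show ?case
  proof
    assume "y = 0"
    then show ?thesis using g m step(3) by auto
  next
    assume "\<exists>r\<in>words. P r \<and> y \<in> relations (\<lambda>w. w = r \<or> w \<prec> r)"
    then obtain r where r: "r \<in> words" "P r" "y \<in> relations (\<lambda>w. w = r \<or> w \<prec> r)" by blast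
    consider "?m = r \<or> ?m \<prec> r" | "r \<prec> ?m" using prec_total[OF m r(1)] by blast
    then show ?thesis
    proof cases
      case 1
      then have "?g \<in> relations (\<lambda>w. w = r \<or> w \<prec> r)"
        by (intro relations_mono[OF g]) (use m r(1) prec_trans in blast)
      then show ?thesis using r relations_add by blast
    next
      case 2
      then have "y \<in> relations (\<lambda>w. w = ?m \<or> w \<prec> ?m)"
        by (intro relations_mono[OF r(3)]) (use m r(1) prec_trans in blast)
      then show ?thesis using g m step(3) relations_add by blast
    qed
  qed
qed simp

text \<open>
  A representation with minimal bound cannot be lowered by \<open>relations_peel\<close>, so the bound survives in
  the support.
\<close>

lemma relations_reducible:
  assumes "x \<in> relations P" "x \<noteq> 0"
  shows "\<exists>w\<in>Poly_Mapping.keys x. reducible w"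
proof -
  have bounded: "\<exists>w\<in>Poly_Mapping.keys x. reducible w"
    if "r \<in> words" "x \<in> relations (\<lambda>w. w = r \<or> w \<prec> r)" for r
    using prec_wf that
  proof (induction r rule: wfp_on_induct)
    case (less r)
    then show ?case
      using relations_peel[of x r] relations_bounded[of x "\<lambda>w. w \<prec> r"] assms(2) by blast
  qed (use that in simp)
  then show ?thesis using relations_bounded[OF assms(1)] assms(2) by blast
qed

text \<open>
  Two normal forms of the same element differ by a relation in which no word is reducible, hence they are equal.
\<close>

lemma confluent: "confluent \<Omega> X"
  unfolding confluent_def
proof (intro ballI allI impI)
  fix a b c
  assume a: "a \<in> free_algebra \<Omega> (gens X)"
    and bc: "(rewriting_step \<Omega> X)\<^sup>*\<^sup>* a b \<and> (rewriting_step \<Omega> X)\<^sup>*\<^sup>* a c"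
  obtain b' where b': "(rewriting_step \<Omega> X)\<^sup>*\<^sup>* b b'" "\<forall>w\<in>Poly_Mapping.keys b'. \<not> reducible w"
    using normal_form_exists[OF rewriting_free_algebra[OF _ a]] bc by blast
  obtain c' where c': "(rewriting_step \<Omega> X)\<^sup>*\<^sup>* c c'" "\<forall>w\<in>Poly_Mapping.keys c'. \<not> reducible w"
    using normal_form_exists[OF rewriting_free_algebra[OF _ a]] bc by blast
  have "(a - c') - (a - b') \<in> relations (\<lambda>w. True)"
    using bc b' c' by (intro relations_diff rewriting_relations) auto
  then have "b' - c' \<in> relations (\<lambda>w. True)" by simp
  moreover have "Poly_Mapping.keys (b' - c') \<subseteq> Poly_Mapping.keys b' \<union> Poly_Mapping.keys c'"
    by (rule Poly_Mapping.keys_diff)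
  ultimately have "b' - c' = 0" using relations_reducible[of "b' - c'"] b'(2) c'(2) by blast
  then have "b' = c'" by simp
  then show "\<exists>d. (rewriting_step \<Omega> X)\<^sup>*\<^sup>* b d \<and> (rewriting_step \<Omega> X)\<^sup>*\<^sup>* c d"
    using b' c' by blast
qed

end

theorem proposition3p3p3:
  fixes \<Omega> :: "'o set"
    and X :: "('z, 'o, 'k::field_char_0, 'r) polygraph"
    and prec :: "('z, 'o) word \<Rightarrow> ('z, 'o) word \<Rightarrow> bool"
  assumes "left_monomial_polygraph \<Omega> X"
    and "monomial_order \<Omega> (gens X) prec"
    and "compatible_order X prec"
    and "groebner_shirshov_basis \<Omega> X prec (boundary X)"
  shows "convergent_polygraph \<Omega> X"
proof -
  interpret groebner_polygraph \<Omega> X prec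
    using assms by unfold_locales
  show ?thesis unfolding convergent_polygraph_def using terminating confluent by blast
qed

end
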